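(* Let $S\neq\mathbb{N}$ be a GAS numerical semigroup that is not symmetric. Then $\langle K\rangle\setminus K=\{F(S)-x_1,\dots,F(S)-x_r,F(S)\}$ for some $r\ge 0$ and some minimal generators $x_1,\dots,x_r$ of $S$ such that $x_i-x_j\notin PF(S)$ for every $i$ and $j$.
   Context: A numerical semigroup is a submonoid $S$ of $(\mathbb{N},+)$ (with $0\in\mathbb{N}$) such that $\mathbb{N}\setminus S$ is finite. $F(S)=\max(\mathbb{Z}\setminus S)$, $M=S\setminus\{0\}$, $K=\{x\in\mathbb{N}\mid F(S)-x\notin S\}$, and $\langle K\rangle$ is the numerical semigroup generated by $K$. $S$ has a unique minimal system of generators, whose elements are the minimal generators of $S$. For sets $X,Y\subseteq\mathbb{Z}$, $X-Y=\{z\in\mathbb{Z}\mid z+Y\subseteq X\}$; $2K=K+K$. $PF(S)=(S-M)\setminus S$. $S$ is symmetric if $S=K$. $S$ is GAS if either $2K=K$ or $2K\setminus K=\{F(S)-x_1,\dots,F(S)-x_r,F(S)\}$ for some $r\ge 0$ and some minimal generators $x_1,\dots,x_r$ of $S$ such that $x_i-x_j\notin PF(S)$ for every $i,j$. *)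

theory Defs
  imports "HOL-Library.Set_Algebras" "HOL.Hull"
begin

text \<open>
  Numerical semigroups are represented as sets of integers contained in \<open>\<nat>\<close>, because the
  constructions below live in the integers (\<open>F(S)\<close> may be \<open>-1\<close>, pseudo-Frobenius numbers of
  \<open>\<nat>\<close> and differences of generators may be negative).
\<close>

definition add_submonoid :: "int set \<Rightarrow> bool" where
  "add_submonoid T \<longleftrightarrow> 0 \<in> T \<and> (\<forall>x\<in>T. \<forall>y\<in>T. x + y \<in> T)"

definition numerical_semigroup :: "int set \<Rightarrow> bool" where
  "numerical_semigroup S \<longleftrightarrow> S \<subseteq> \<nat> \<and> add_submonoid S \<and> finite (\<nat> - S)"

definition gen :: "int set \<Rightarrow> int set" where
  "gen X = add_submonoid hull X"

definition minimal_system :: "int set \<Rightarrow> int set \<Rightarrow> bool" where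
  "minimal_system A S \<longleftrightarrow> gen A = S \<and> (\<forall>B. B \<subset> A \<longrightarrow> gen B \<noteq> S)"

text \<open>The definite description is justified by \<open>ex1_minimal_system\<close> below.\<close>

definition minimal_generators :: "int set \<Rightarrow> int set" where
  "minimal_generators S = (THE A. minimal_system A S)"

text \<open>
  \<open>Max\<close> is unusable for the Frobenius number, since the complement of \<open>S\<close> in the integers is
  infinite (it contains all negative integers).
\<close>

definition frobenius :: "int set \<Rightarrow> int" where
  "frobenius S = (GREATEST z. z \<notin> S)"

definition max_ideal :: "int set \<Rightarrow> int set" where
  "max_ideal S = S - {0}"

definition canonical :: "int set \<Rightarrow> int set" where
  "canonical S = {x \<in> \<nat>. frobenius S - x \<notin> S}"

text \<open>The set usually written \<open>X - Y\<close>, not to be confused with the set difference.\<close>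

definition set_colon :: "int set \<Rightarrow> int set \<Rightarrow> int set" where
  "set_colon X Y = {z. z +o Y \<subseteq> X}"

definition PF :: "int set \<Rightarrow> int set" where
  "PF S = set_colon S (max_ideal S) - S"

definition symmetric :: "int set \<Rightarrow> bool" where
  "symmetric S \<longleftrightarrow> S = canonical S"

text \<open>Below, \<open>canonical S + canonical S\<close> is the elementwise sum of sets.\<close>

definition GAS :: "int set \<Rightarrow> bool" where
  "GAS S \<longleftrightarrow>
     canonical S + canonical S = canonical S \<or>
     (\<exists>(r::nat) (x :: nat \<Rightarrow> int).
        (\<forall>i\<in>{1..r}. x i \<in> minimal_generators S) \<and>
        (\<forall>i\<in>{1..r}. \<forall>j\<in>{1..r}. x i - x j \<notin> PF S) \<and>
        (canonical S + canonical S) - canonical S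
          = {frobenius S - x i | i. i \<in> {1..r}} \<union> {frobenius S})"

lemma add_submonoid_gen: "add_submonoid (gen X)"
  unfolding gen_def by (rule hull_in) (auto simp: add_submonoid_def)

lemma gen_superset: "X \<subseteq> gen X"
  unfolding gen_def by (rule hull_subset)

lemma gen_least: "X \<subseteq> T \<Longrightarrow> add_submonoid T \<Longrightarrow> gen X \<subseteq> T"
  unfolding gen_def by (rule hull_minimal)

lemma ex1_minimal_system:
  assumes "numerical_semigroup S"
  shows "\<exists>!A. minimal_system A S"
proof -
  define I where "I = {x \<in> S - {0}. \<forall>y\<in>S - {0}. \<forall>z\<in>S - {0}. x \<noteq> y + z}"
  have S: "add_submonoid S" "S \<subseteq> \<nat>"
    using assms by (auto simp: numerical_semigroup_def)
  have pos: "x > 0" if "x \<in> S - {0}" for x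
    using that S(2) by (auto elim!: Nats_cases)
  have "x \<in> gen I" if "x \<in> S" for x
    using that
  proof (induction "nat x" arbitrary: x rule: less_induct)
    case less
    show ?case
    proof (cases "x = 0 \<or> x \<in> I")
      case True
      then show ?thesis
        using add_submonoid_gen[of I] gen_superset[of I] by (auto simp: add_submonoid_def)
    next
      case False
      then obtain y z where yz: "y \<in> S - {0}" "z \<in> S - {0}" "x = y + z"
        using less.prems unfolding I_def by blast
      have "y \<in> gen I" "z \<in> gen I"
        using less.hyps[of y] less.hyps[of z] yz pos[of y] pos[of z] by auto
      then show ?thesis
        using yz(3) add_submonoid_gen[of I] by (auto simp: add_submonoid_def)
    qed
  qed
  moreover have "gen I \<subseteq> S"
    by (rule gen_least) (use S in \<open>auto simp: I_def\<close>)
  ultimately have gen_I: "gen I = S"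
    by blast
  have sub: "I \<subseteq> B" if "gen B = S" for B
  proof
    fix x assume x: "x \<in> I"
    show "x \<in> B"
    proof (rule ccontr)
      assume "x \<notin> B"
      have "B \<subseteq> S"
        using that gen_superset by blast
      moreover have "add_submonoid (S - {x})"
        unfolding add_submonoid_def
      proof (intro conjI ballI)
        show "0 \<in> S - {x}"
          using S(1) x by (auto simp: add_submonoid_def I_def)
      next
        fix y z assume yz: "y \<in> S - {x}" "z \<in> S - {x}"
        then have "y + z \<in> S"
          using S(1) by (auto simp: add_submonoid_def)
        moreover have "y + z \<noteq> x"
          using x yz by (cases "y = 0"; cases "z = 0") (auto simp: I_def)
        ultimately show "y + z \<in> S - {x}"
          by simp
      qed
      ultimately have "gen B \<subseteq> S - {x}"
        using \<open>x \<notin> B\<close> by (intro gen_least) auto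
      then show False
        using that x by (auto simp: I_def)
    qed
  qed
  have "minimal_system I S"
    using gen_I sub by (auto simp: minimal_system_def)
  moreover have "A = I" if "minimal_system A S" for A
    using that gen_I sub[of A] by (auto simp: minimal_system_def)
  ultimately show ?thesis
    by blast
qed

end

theory Submission
  imports Defs
begin

text \<open>
  Write \<open>F\<close>, \<open>K\<close>, \<open>M\<close> for the Frobenius number, the canonical ideal and the maximal ideal of
  \<open>S\<close>. An integer \<open>z\<close> lies outside \<open>K\<close> exactly when \<open>F - z \<in> S\<close>. Hence, for every \<open>L\<close>, the
  elements of \<open>L - K\<close> different from \<open>F\<close> are the numbers \<open>F - x\<close> with \<open>x\<close> in
  \<open>R(L) = {x \<in> M. F - x \<in> L}\<close>. Call \<open>R(L)\<close> admissible if it consists of minimal generators no two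
  of which differ by a pseudo-Frobenius number. If \<open>S\<close> is not symmetric, then \<open>F \<in> 2K\<close>, so GAS says
  that \<open>R(2K)\<close> is admissible, and the goal is that \<open>R(\<langle>K\<rangle>)\<close> is. As \<open>\<langle>K\<rangle>\<close> is the union of the
  increasing chain \<open>nK\<close>, it suffices to pass from \<open>R(nK)\<close> to \<open>R((n+1)K)\<close>.

  Three observations drive this step.

  \<^item> By duality, if \<open>k \<in> K - S\<close> and \<open>m \<in> M\<close> satisfy \<open>k + m \<notin> S\<close>, then \<open>F - k - m \<in> K\<close>, whence
    \<open>m \<in> R(2K)\<close>. In particular \<open>k + m \<in> S\<close> whenever \<open>m\<close> is not a minimal generator
    (\<open>canonical_plus_ideal\<close>).

  \<^item> Adding a pseudo-Frobenius number to an element of \<open>K\<close> yields an element of \<open>K\<close> or \<open>F\<close>. So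
    \<open>x \<in> R(nK)\<close>, \<open>y \<in> M\<close> and \<open>x - y \<in> PF S\<close> imply \<open>y \<in> R(nK)\<close> (\<open>reflection_shift\<close>); if \<open>R(nK)\<close>
    is admissible, no such \<open>x\<close> and \<open>y\<close> exist (\<open>not_PF_if_admissible\<close>).

  \<^item> A new element \<open>s\<close> of \<open>R((n+1)K)\<close> has the form \<open>x - k\<close> with \<open>x \<in> R(nK)\<close> and \<open>k \<in> K - S\<close>
    (\<open>reflection_Suc_cases\<close>).

  If such an \<open>s\<close> were a sum \<open>a + b\<close> of elements of \<open>M\<close>, then \<open>x - a = k + b\<close> would be
  pseudo-Frobenius, by the first observation applied to the reducible elements \<open>b + m\<close>. If
  \<open>s - t = p\<close> were pseudo-Frobenius for some \<open>t \<in> M\<close>, then so would be \<open>x - t = k + p\<close>, by the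
  first observation applied to the elements \<open>p + m\<close>. Both are impossible by the second observation.
\<close>

lemma int_mem_Nats_iff: "(x :: int) \<in> \<nat> \<longleftrightarrow> 0 \<le> x"
proof
  assume "0 \<le> x"
  then have "x = of_nat (nat x)" by simp
  then show "x \<in> \<nat>" by (metis of_nat_in_Nats)
qed (auto elim!: Nats_cases)


section \<open>Minimal generators as irreducible elements\<close>

definition irreducibles :: "int set \<Rightarrow> int set" where
  "irreducibles S = {x \<in> max_ideal S. \<forall>y\<in>max_ideal S. \<forall>z\<in>max_ideal S. x \<noteq> y + z}"

lemma gen_irreducibles:
  assumes "numerical_semigroup S"
  shows "gen (irreducibles S) = S"
proof
  show "gen (irreducibles S) \<subseteq> S"
    by (rule gen_least)
      (use assms in \<open>auto simp: irreducibles_def max_ideal_def numerical_semigroup_def\<close>)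
next
  let ?G = "gen (irreducibles S)"
  have G: "0 \<in> ?G" "\<And>u v. u \<in> ?G \<Longrightarrow> v \<in> ?G \<Longrightarrow> u + v \<in> ?G" "irreducibles S \<subseteq> ?G"
    using add_submonoid_gen[of "irreducibles S"] gen_superset[of "irreducibles S"]
    by (auto simp: add_submonoid_def)
  have pos: "x > 0" if "x \<in> max_ideal S" for x
    using that assms by (auto simp: max_ideal_def numerical_semigroup_def elim!: Nats_cases)
  show "S \<subseteq> ?G"
  proof
    fix x assume "x \<in> S"
    then show "x \<in> ?G"
    proof (induction "nat x" arbitrary: x rule: less_induct)
      case less
      show ?case
      proof (cases "x = 0 \<or> x \<in> irreducibles S")
        case True
        then show ?thesis using G by auto
      next
        case False
        then obtain y z where yz: "y \<in> max_ideal S" "z \<in> max_ideal S" "x = y + z"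
          using less.prems unfolding irreducibles_def max_ideal_def by blast
        then have "y \<in> ?G" "z \<in> ?G"
          using less.hyps[of y] less.hyps[of z] pos[of y] pos[of z] by (auto simp: max_ideal_def)
        then show ?thesis using G(2) yz(3) by simp
      qed
    qed
  qed
qed

text \<open>
  Removing an irreducible element from \<open>S\<close> leaves a submonoid, so a set that omits the element
  cannot generate \<open>S\<close>.
\<close>
lemma irreducibles_subset_generators:
  assumes "numerical_semigroup S" and "gen B = S"
  shows "irreducibles S \<subseteq> B"
proof
  fix x assume x: "x \<in> irreducibles S"
  show "x \<in> B"
  proof (rule ccontr)
    assume "x \<notin> B"
    have S: "0 \<in> S" "\<And>u v. u \<in> S \<Longrightarrow> v \<in> S \<Longrightarrow> u + v \<in> S"
      using assms(1) by (auto simp: numerical_semigroup_def add_submonoid_def)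
    have "y + z \<noteq> x" if "y \<in> S - {x}" "z \<in> S - {x}" for y z
      using x that by (cases "y = 0"; cases "z = 0") (auto simp: irreducibles_def max_ideal_def)
    then have "add_submonoid (S - {x})"
      using x S by (auto simp: add_submonoid_def irreducibles_def max_ideal_def)
    then have "gen B \<subseteq> S - {x}"
      using \<open>x \<notin> B\<close> assms(2) gen_superset[of B] by (intro gen_least) auto
    then show False
      using x assms(2) by (auto simp: irreducibles_def max_ideal_def)
  qed
qed

lemma minimal_generators_eq_irreducibles:
  assumes "numerical_semigroup S"
  shows "minimal_generators S = irreducibles S"
proof -
  have "minimal_system (minimal_generators S) S"
    unfolding minimal_generators_def by (rule theI', rule ex1_minimal_system, rule assms)
  then show ?thesis
    using irreducibles_subset_generators[OF assms] gen_irreducibles[OF assms]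
    unfolding minimal_system_def by blast
qed


section \<open>The canonical ideal and pseudo-Frobenius numbers\<close>

text \<open>
  Excluding \<open>S = \<nat>\<close> makes the Frobenius number positive, which the sign arguments below rely on.
\<close>
locale proper_numerical_semigroup =
  fixes S :: "int set"
  assumes semigroup: "numerical_semigroup S" and proper: "S \<noteq> \<nat>"
begin

abbreviation "F \<equiv> frobenius S"
abbreviation "K \<equiv> canonical S"
abbreviation "M \<equiv> max_ideal S"

lemma zero_mem: "0 \<in> S"
  and add_mem: "x \<in> S \<Longrightarrow> y \<in> S \<Longrightarrow> x + y \<in> S"
  and nonneg: "x \<in> S \<Longrightarrow> x \<ge> 0"
  using semigroup by (auto simp: numerical_semigroup_def add_submonoid_def elim!: Nats_cases)

lemma ideal_iff: "x \<in> M \<longleftrightarrow> x \<in> S \<and> x > 0"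
  using nonneg[of x] by (auto simp: max_ideal_def)

lemma irreducible_not_sum:
  "x \<in> irreducibles S \<Longrightarrow> y \<in> M \<Longrightarrow> z \<in> M \<Longrightarrow> x \<noteq> y + z"
  by (auto simp: irreducibles_def)

lemma frobenius_not_mem: "F \<notin> S"
  and mem_above_frobenius: "z > F \<Longrightarrow> z \<in> S"
  and frobenius_pos: "F > 0"
proof -
  let ?f = "Max (\<nat> - S)"
  have fin: "finite (\<nat> - S)" and ne: "\<nat> - S \<noteq> {}"
    using semigroup proper by (auto simp: numerical_semigroup_def)
  have f: "?f \<in> \<nat> - S"
    using Max_in[OF fin ne] .
  then have f0: "?f \<ge> 0"
    by (auto elim!: Nats_cases)
  have le: "z \<le> ?f" if "z \<notin> S" for z
  proof (cases "z \<ge> 0")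
    case True
    then have "z \<in> \<nat> - S"
      using that by (simp add: int_mem_Nats_iff)
    then show ?thesis using fin by simp
  qed (use f0 in simp)
  have "F = ?f"
    unfolding frobenius_def by (rule Greatest_equality) (use f le in auto)
  moreover have "?f \<noteq> 0"
    using f zero_mem by auto
  ultimately show "F \<notin> S" "z > F \<Longrightarrow> z \<in> S" "F > 0"
    using f f0 le[of z] by auto
qed

text \<open>
  Negative \<open>z\<close> satisfy \<open>F - z > F\<close>, so the restriction to \<open>\<nat>\<close> in the definition of the canonical
  ideal is automatic.
\<close>
lemma canonical_iff: "z \<in> K \<longleftrightarrow> F - z \<notin> S"
  using mem_above_frobenius[of "F - z"]
  by (cases "z \<ge> 0") (auto simp: canonical_def int_mem_Nats_iff)

lemma canonical_nonneg: "k \<in> K \<Longrightarrow> k \<ge> 0"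
  by (auto simp: canonical_def int_mem_Nats_iff)

lemma zero_mem_canonical: "0 \<in> K"
  by (simp add: canonical_iff frobenius_not_mem)

lemma semigroup_subset_canonical: "S \<subseteq> K"
  using add_mem frobenius_not_mem by (force simp: canonical_iff)

lemma frobenius_not_canonical: "F \<notin> K"
  by (simp add: canonical_iff zero_mem)

text \<open>An element \<open>k \<in> K - S\<close> is paired with \<open>F - k\<close>, which again lies in \<open>K\<close>.\<close>
lemma frobenius_mem_double_canonical:
  assumes "\<not> symmetric S"
  shows "F \<in> K + K"
proof -
  obtain k where k: "k \<in> K" "k \<notin> S"
    using assms semigroup_subset_canonical by (auto simp: symmetric_def)
  then have "F - k \<in> K"
    by (simp add: canonical_iff)
  then show ?thesis
    using k(1) set_plus_intro[of k K "F - k" K] by simp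
qed

lemma PF_iff: "p \<in> PF S \<longleftrightarrow> p \<notin> S \<and> (\<forall>m\<in>M. p + m \<in> S)"
  by (auto simp: PF_def set_colon_def elt_set_plus_def)

lemma PF_pos:
  assumes "p \<in> PF S"
  shows "p > 0"
proof (rule ccontr)
  assume p: "\<not> p > 0"
  moreover have "p \<noteq> 0"
    using assms zero_mem by (auto simp: PF_iff)
  ultimately have "F - p \<in> M"
    using mem_above_frobenius[of "F - p"] frobenius_pos by (simp add: ideal_iff)
  then have "p + (F - p) \<in> S"
    using assms unfolding PF_iff by blast
  then show False
    using frobenius_not_mem by simp
qed

text \<open>
  If \<open>k + p \<notin> K\<close>, then \<open>s = F - k - p\<close> lies in \<open>S\<close>; a nonzero \<open>s\<close> would give
  \<open>F - k = p + s \<in> S\<close>, against \<open>k \<in> K\<close>.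
\<close>
lemma canonical_plus_PF:
  assumes "k \<in> K" "p \<in> PF S" "k + p \<noteq> F"
  shows "k + p \<in> K"
proof (rule ccontr)
  assume "k + p \<notin> K"
  then have "F - (k + p) \<in> M"
    using assms(3) by (auto simp: canonical_iff max_ideal_def)
  then have "p + (F - (k + p)) \<in> S"
    using assms(2) unfolding PF_iff by blast
  then show False
    using assms(1) by (simp add: canonical_iff algebra_simps)
qed


section \<open>Reflecting the multiples of the canonical ideal\<close>

abbreviation multiple :: "nat \<Rightarrow> int set" where
  "multiple n \<equiv> \<Sum>i<n. K"

definition reflection :: "int set \<Rightarrow> int set" where
  "reflection L = {x \<in> M. F - x \<in> L}"

definition admissible :: "int set \<Rightarrow> bool" where
  "admissible X \<longleftrightarrow> X \<subseteq> irreducibles S \<and> (\<forall>x\<in>X. \<forall>y\<in>X. x - y \<notin> PF S)"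

lemma multiple_2: "multiple 2 = K + K"
  by (simp add: numeral_2_eq_2)

lemma multiple_mono: "m \<le> n \<Longrightarrow> multiple m \<subseteq> multiple n"
proof (induction rule: dec_induct)
  case (step n)
  have "multiple n \<subseteq> multiple (Suc n)"
    using zero_mem_canonical set_plus_intro[of _ "multiple n" 0 K] by auto
  then show ?case using step by blast
qed simp

lemma reflection_mono: "L \<subseteq> L' \<Longrightarrow> reflection L \<subseteq> reflection L'"
  by (auto simp: reflection_def)

lemma multiple_nonneg: "z \<in> multiple n \<Longrightarrow> z \<ge> 0"
proof (induction n arbitrary: z)
  case (Suc n)
  then show ?case
    using canonical_nonneg by (force elim!: set_plus_elim)
qed simp

lemma multiple_add:
  assumes "x \<in> multiple m" "y \<in> multiple n"
  shows "x + y \<in> multiple (m + n)"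
  using assms(2)
proof (induction n arbitrary: y)
  case (Suc n)
  then obtain u k where "y = u + k" "u \<in> multiple n" "k \<in> K"
    by (auto elim!: set_plus_elim)
  then show ?case
    using Suc.IH[of u] set_plus_intro[of "x + u" "multiple (m + n)" k K] by (simp add: add.assoc)
qed (use assms(1) in simp)

lemma gen_canonical_subset: "gen K \<subseteq> (\<Union>n. multiple n)"
proof (rule gen_least)
  have "multiple 1 = K" by simp
  then show "K \<subseteq> (\<Union>n. multiple n)" by blast
  have "(0::int) \<in> multiple 0" by simp
  then show "add_submonoid (\<Union>n. multiple n)"
    using multiple_add unfolding add_submonoid_def by blast
qed

text \<open>
  Nothing of \<open>S\<close> reflects into \<open>K\<close>, so \<open>reflection L\<close> only sees \<open>L - K\<close>; it loses the single
  element \<open>F\<close>, the reflection of \<open>0\<close>.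
\<close>
lemma diff_canonical_eq:
  assumes "F \<in> L"
  shows "L - K = {F - x | x. x \<in> reflection L} \<union> {F}"
proof -
  have "z \<in> L - K \<longleftrightarrow> z \<in> {F - x | x. x \<in> reflection L} \<union> {F}" for z
  proof -
    have "z \<in> L - K \<longleftrightarrow> z \<in> L \<and> F - z \<in> S"
      by (auto simp: canonical_iff)
    also have "\<dots> \<longleftrightarrow> F - z \<in> reflection L \<or> z = F"
      using assms zero_mem by (auto simp: reflection_def max_ideal_def)
    also have "F - z \<in> reflection L \<longleftrightarrow> (\<exists>x. z = F - x \<and> x \<in> reflection L)"
      by (metis diff_diff_eq2 add_diff_cancel_left')
    finally show ?thesis by auto
  qed
  then show ?thesis by blast
qed

text \<open>If \<open>k + m \<notin> S\<close>, then \<open>F - m = k + (F - k - m)\<close> is a sum of two elements of \<open>K\<close>.\<close>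
lemma canonical_plus_ideal:
  assumes "k \<in> K" "m \<in> M" "m \<notin> reflection (multiple 2)"
  shows "k + m \<in> S"
proof (rule ccontr)
  assume "k + m \<notin> S"
  then have "F - (k + m) \<in> K"
    by (simp add: canonical_iff)
  then have "F - m \<in> multiple 2"
    using set_plus_intro[OF assms(1), of "F - (k + m)" K] by (simp add: multiple_2)
  then show False
    using assms by (simp add: reflection_def)
qed

lemma multiple_plus_PF:
  assumes "z \<in> multiple n" "p \<in> PF S" "z + p < F" "n > 0"
  shows "z + p \<in> multiple n"
proof -
  obtain n' where n: "n = Suc n'"
    using assms(4) gr0_implies_Suc by blast
  then obtain u k where uk: "z = u + k" "u \<in> multiple n'" "k \<in> K"
    using assms(1) by (auto elim!: set_plus_elim)
  \<comment> \<open>The exceptional value \<open>F\<close> of \<open>k + p\<close> is excluded by size.\<close>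
  have "k + p \<in> K"
    using canonical_plus_PF[OF uk(3) assms(2)] multiple_nonneg[OF uk(2)] uk(1) assms(3) by linarith
  then show ?thesis
    using set_plus_intro[OF uk(2), of "k + p" K] uk(1) n by (simp add: add.assoc)
qed

lemma reflection_shift:
  assumes "x \<in> reflection (multiple n)" "y \<in> M" "x - y \<in> PF S" "n > 0"
  shows "y \<in> reflection (multiple n)"
  using multiple_plus_PF[of "F - x" n "x - y"] assms by (simp add: reflection_def ideal_iff)

lemma not_PF_if_admissible:
  assumes "admissible (reflection (multiple n))" "n > 0" "x \<in> reflection (multiple n)" "y \<in> M"
  shows "x - y \<notin> PF S"
  using assms reflection_shift unfolding admissible_def by blast

lemma reflection_Suc_cases:
  assumes "s \<in> reflection (multiple (Suc n))" "s \<notin> reflection (multiple n)"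
    and "2 \<le> n" and adm: "admissible (reflection (multiple n))"
  obtains x k where "x \<in> reflection (multiple n)" "k \<in> K" "k \<notin> S" "x = s + k"
proof -
  have s: "s \<in> M" and "F - s \<in> multiple n + K"
    using assms(1) by (auto simp: reflection_def)
  then obtain u k where uk: "F - s = u + k" "u \<in> multiple n" "k \<in> K"
    by (auto elim!: set_plus_elim)
  have not_n: "F - s \<notin> multiple n"
    using assms(2) s by (simp add: reflection_def)
  have "u \<notin> K"
  proof
    assume "u \<in> K"
    then have "F - s \<in> multiple 2"
      using uk set_plus_intro[of u K k K] by (simp add: multiple_2)
    then show False
      using not_n multiple_mono[OF \<open>2 \<le> n\<close>] by blast
  qed
  then have "F - u \<in> S"
    by (simp add: canonical_iff)
  moreover have "F - u > 0"
    using uk(1) canonical_nonneg[OF uk(3)] s by (simp add: ideal_iff)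
  ultimately have x: "F - u \<in> reflection (multiple n)"
    using uk(2) by (simp add: reflection_def ideal_iff)
  have sum: "F - u = s + k"
    using uk(1) by simp
  \<comment> \<open>The irreducible element \<open>F - u\<close> could only split inside \<open>S\<close> trivially, and \<open>k \<noteq> 0\<close>.\<close>
  have "k \<notin> M"
    using x sum s adm irreducible_not_sum unfolding admissible_def by blast
  moreover have "k \<noteq> 0"
    using uk not_n by auto
  ultimately have "k \<notin> S"
    by (simp add: max_ideal_def)
  with x sum uk(3) show thesis
    using that by blast
qed

lemma admissible_Suc:
  assumes "2 \<le> n" and adm: "admissible (reflection (multiple n))"
  shows "admissible (reflection (multiple (Suc n)))"
proof -
  let ?R = "\<lambda>n. reflection (multiple n)"
  have n: "n > 0"
    using assms(1) by simp
  have R2: "?R 2 \<subseteq> ?R n"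
    by (intro reflection_mono multiple_mono assms(1))
  have irr: "x \<noteq> y + z" if "x \<in> ?R n" "y \<in> M" "z \<in> M" for x y z
    using that adm irreducible_not_sum unfolding admissible_def by blast
  have "s \<in> irreducibles S" if s: "s \<in> ?R (Suc n)" for s
  proof (cases "s \<in> ?R n")
    case True
    then show ?thesis using adm by (auto simp: admissible_def)
  next
    case False
    obtain x k where x: "x \<in> ?R n" and k: "k \<in> K" "k \<notin> S" and x_eq: "x = s + k"
      using reflection_Suc_cases[OF s False assms] by blast
    have "s \<noteq> a + b" if a: "a \<in> M" and b: "b \<in> M" for a b
    proof
      assume s_eq: "s = a + b"
      have "k + b \<in> PF S"
        unfolding PF_iff
      proof
        have "k + b \<notin> M"
          using irr[OF x a, of "k + b"] x_eq s_eq by auto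
        then show "k + b \<notin> S"
          using b canonical_nonneg[OF k(1)] by (simp add: ideal_iff)
        show "\<forall>m\<in>M. k + b + m \<in> S"
        proof
          fix m assume m: "m \<in> M"
          have bm: "b + m \<in> M"
            using b m add_mem by (simp add: ideal_iff)
          have "b + m \<notin> ?R 2"
            using irr[OF _ b m] R2 by blast
          then show "k + b + m \<in> S"
            using canonical_plus_ideal[OF k(1) bm] by (simp add: add.assoc)
        qed
      qed
      then show False
        using not_PF_if_admissible[OF adm n x a] x_eq s_eq by (simp add: add.commute)
    qed
    then show ?thesis
      using s by (auto simp: irreducibles_def reflection_def)
  qed
  moreover have "s - t \<notin> PF S" if s: "s \<in> ?R (Suc n)" and t: "t \<in> M" for s t
  proof (cases "s \<in> ?R n")
    case True
    then show ?thesis using not_PF_if_admissible[OF adm n _ t] by blast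
  next
    case False
    obtain x k where x: "x \<in> ?R n" and k: "k \<in> K" "k \<notin> S" and x_eq: "x = s + k"
      using reflection_Suc_cases[OF s False assms] by blast
    show ?thesis
    proof
      define p where "p = s - t"
      assume "s - t \<in> PF S"
      then have p: "p \<in> PF S"
        by (simp add: p_def)
      have "k + p \<in> PF S"
        unfolding PF_iff
      proof
        have "k + p \<notin> M"
          using irr[OF x t, of "k + p"] x_eq by (auto simp: p_def)
        then show "k + p \<notin> S"
          using canonical_nonneg[OF k(1)] PF_pos[OF p] by (simp add: ideal_iff)
        show "\<forall>m\<in>M. k + p + m \<in> S"
        proof
          fix m assume m: "m \<in> M"
          have pm: "p + m \<in> M"
            using p m PF_pos[OF p] by (simp add: PF_iff ideal_iff)
          \<comment> \<open>Otherwise \<open>p + m \<in> R(nK)\<close> would exceed \<open>m \<in> M\<close> by the pseudo-Frobenius number \<open>p\<close>.\<close>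
          have "p + m \<notin> ?R 2"
            using not_PF_if_admissible[OF adm n _ m, of "p + m"] p R2 by auto
          then show "k + p + m \<in> S"
            using canonical_plus_ideal[OF k(1) pm] by (simp add: add.assoc)
        qed
      qed
      then show False
        using not_PF_if_admissible[OF adm n x t] x_eq by (simp add: p_def algebra_simps)
    qed
  qed
  ultimately show ?thesis
    by (auto simp: admissible_def reflection_def)
qed

lemma admissible_gen_canonical:
  assumes "admissible (reflection (K + K))"
  shows "admissible (reflection (gen K))"
proof -
  have adm: "admissible (reflection (multiple n))" if "2 \<le> n" for n
    using that
  proof (induction rule: dec_induct)
    case base
    then show ?case using assms by (simp add: multiple_2)
  next
    case (step n)
    then show ?case using admissible_Suc by blast
  qed
  \<comment> \<open>The multiples increase, so finitely many elements of \<open>\<langle>K\<rangle>\<close> lie in a common one.\<close>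
  have "\<exists>n\<ge>2. x \<in> reflection (multiple n) \<and> y \<in> reflection (multiple n)"
    if xy: "x \<in> reflection (gen K)" "y \<in> reflection (gen K)" for x y
  proof -
    obtain i j where ij: "x \<in> reflection (multiple i)" "y \<in> reflection (multiple j)"
      using xy gen_canonical_subset unfolding reflection_def by blast
    define n where "n = i + j + 2"
    have "i \<le> n" "j \<le> n" "2 \<le> n"
      by (simp_all add: n_def)
    then show ?thesis
      using ij reflection_mono[OF multiple_mono, of i n] reflection_mono[OF multiple_mono, of j n]
      by blast
  qed
  then show ?thesis
    using adm unfolding admissible_def by (metis subset_iff)
qed


section \<open>Enumerated form of admissibility\<close>

lemma finite_reflection_gen: "finite (reflection (gen K))"
proof (rule finite_subset)
  show "reflection (gen K) \<subseteq> {0..F}"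
    using gen_canonical_subset multiple_nonneg by (force simp: reflection_def ideal_iff)
qed simp

lemma admissible_of_GAS:
  assumes "GAS S" "\<not> symmetric S"
  shows "admissible (reflection (K + K))"
proof -
  have "K + K \<noteq> K"
    using frobenius_mem_double_canonical[OF assms(2)] frobenius_not_canonical by auto
  then obtain r :: nat and x :: "nat \<Rightarrow> int"
    where gens: "\<forall>i\<in>{1..r}. x i \<in> irreducibles S"
      and PF: "\<forall>i\<in>{1..r}. \<forall>j\<in>{1..r}. x i - x j \<notin> PF S"
      and eq: "(K + K) - K = {F - x i | i. i \<in> {1..r}} \<union> {F}"
    using assms(1) minimal_generators_eq_irreducibles[OF semigroup] unfolding GAS_def by auto
  have "\<exists>i\<in>{1..r}. y = x i" if y: "y \<in> reflection (K + K)" for y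
  proof -
    have "F - y \<in> (K + K) - K"
      using y by (auto simp: reflection_def canonical_iff ideal_iff)
    moreover have "y \<noteq> 0"
      using y by (auto simp: reflection_def ideal_iff)
    ultimately show ?thesis
      unfolding eq by auto
  qed
  then show ?thesis
    using gens PF unfolding admissible_def by blast
qed

lemma enumeration_of_admissible:
  assumes "admissible (reflection L)" "finite (reflection L)" "F \<in> L"
  shows "\<exists>(r::nat) (x :: nat \<Rightarrow> int).
           (\<forall>i\<in>{1..r}. x i \<in> minimal_generators S) \<and>
           (\<forall>i\<in>{1..r}. \<forall>j\<in>{1..r}. x i - x j \<notin> PF S) \<and>
           L - K = {F - x i | i. i \<in> {1..r}} \<union> {F}"
proof -
  obtain x where "bij_betw x {1..card (reflection L)} (reflection L)"
    using ex_bij_betw_nat_finite_1[OF assms(2)] by blast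
  then have x: "reflection L = x ` {1..card (reflection L)}"
    by (simp add: bij_betw_def)
  define r where "r = card (reflection L)"
  have R: "reflection L = x ` {1..r}"
    using x by (simp add: r_def)
  have "L - K = {F - x i | i. i \<in> {1..r}} \<union> {F}"
    unfolding diff_canonical_eq[OF assms(3)] R by blast
  moreover have "\<forall>i\<in>{1..r}. x i \<in> minimal_generators S"
    "\<forall>i\<in>{1..r}. \<forall>j\<in>{1..r}. x i - x j \<notin> PF S"
    using assms(1) minimal_generators_eq_irreducibles[OF semigroup]
    unfolding admissible_def R by auto
  ultimately show ?thesis by blast
qed

end


section \<open>The semigroup generated by the canonical ideal of a GAS semigroup\<close>

theorem theorem3p7:
  fixes S :: "int set"
  assumes "numerical_semigroup S"
    and "S \<noteq> \<nat>"
    and "GAS S"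
    and "\<not> symmetric S"
  shows "\<exists>(r::nat) (x :: nat \<Rightarrow> int).
           (\<forall>i\<in>{1..r}. x i \<in> minimal_generators S) \<and>
           (\<forall>i\<in>{1..r}. \<forall>j\<in>{1..r}. x i - x j \<notin> PF S) \<and>
           gen (canonical S) - canonical S
             = {frobenius S - x i | i. i \<in> {1..r}} \<union> {frobenius S}"
proof -
  interpret proper_numerical_semigroup S
    by unfold_locales (use assms in auto)
  have "K + K \<subseteq> gen K"
    using add_submonoid_gen[of K] gen_superset[of K]
    by (auto simp: add_submonoid_def elim!: set_plus_elim)
  then have "F \<in> gen K"
    using frobenius_mem_double_canonical[OF assms(4)] by blast
  then show ?thesis
    by (intro enumeration_of_admissible finite_reflection_gen admissible_gen_canonical
        admissible_of_GAS assms(3,4))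
qed

end
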